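(* Let $\theta>0$, $\lambda>0$, $T>0$, $\Delta t>0$ be real numbers, let $n\ge 1$ be an integer with $n\Delta t\le T$, and let $$L=\max\{1/\theta,\,2\},\qquad M=e^{(1+L)\lambda T}.$$ Let $S(w_0,z_0,z_1,z_2)$ be the stability function (defined in the context) of the second adaptation of the Modified Craig--Sneyd scheme with parameter $\theta$. Consider the condition $$|z_0|\le 2\sqrt{\operatorname{Re} z_1\,\operatorname{Re} z_2}\quad\text{and}\quad \operatorname{Re} z_1\le 0,\ \operatorname{Re} z_2\le 0. \qquad ( * )$$ (a) If $\theta\ge\frac13$, then $|S(w_0,z_0,z_1,z_2)^n|\le M$ whenever $w_0\in\mathbb{C}$ with $|w_0|\le\lambda\Delta t$ and $z_0,z_1,z_2\in\mathbb{R}$ satisfy $( * )$. (b) If $\frac12\le\theta\le 1$, then $|S(w_0,z_0,z_1,z_2)^n|\le M$ whenever $w_0\in\mathbb{C}$ with $|w_0|\le\lambda\Delta t$ and $z_0,z_1,z_2\in\mathbb{C}$ satisfy $( * )$.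
   Context: $\operatorname{Re}$ denotes the real part. For a real parameter $\theta>0$ and complex numbers $w_0,z_0,z_1,z_2$, put $$z=w_0+z_0+z_1+z_2,\qquad p=(1-\theta z_1)(1-\theta z_2),$$ $$S(w_0,z_0,z_1,z_2)=1+\left(1+\tfrac12 w_0\right)\left(\frac{z}{p}+\theta\,\frac{z_0 z}{p^2}+\left(\tfrac12-\theta\right)\frac{(z_0+z_1+z_2)z}{p^2}\right).$$ This is the function such that the second adaptation of the Modified Craig--Sneyd scheme with parameter $\theta$ (integral term treated in a one-step explicit trapezoidal fashion at the start of each step), applied to the scalar test equation $\dot U=(\lambda_0+\mu_0+\mu_1+\mu_2)U$ with step size $\Delta t$, gives $U_n=S(w_0,z_0,z_1,z_2)U_{n-1}$, where $w_0=\lambda_0\Delta t$ and $z_j=\mu_j\Delta t$ for $j=0,1,2$. *)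

theory Defs
  imports Complex_Main
begin

text \<open>
  Stability function of the second adaptation of the Modified Craig--Sneyd scheme with
  parameter \<open>\<theta>\<close>, for the scalar test equation
  \<open>U' = (\<lambda>0 + \<mu>0 + \<mu>1 + \<mu>2) U\<close> with \<open>w0 = \<lambda>0 \<Delta>t\<close> and \<open>zj = \<mu>j \<Delta>t\<close>.
  Note that \<open>z\<close> contains \<open>w0\<close>, whereas the factor \<open>z0 + z1 + z2\<close> in the last term does not.
\<close>

definition mcs2_stab :: "real \<Rightarrow> complex \<Rightarrow> complex \<Rightarrow> complex \<Rightarrow> complex \<Rightarrow> complex" where
  "mcs2_stab \<theta> w0 z0 z1 z2 =
    (let t = complex_of_real \<theta>;
         z = w0 + z0 + z1 + z2;
         p = (1 - t * z1) * (1 - t * z2)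
     in 1 + (1 + 1/2 * w0) *
          (z / p + t * (z0 * z / p^2) + (1/2 - t) * ((z0 + z1 + z2) * z / p^2)))"

definition mixed_condition :: "complex \<Rightarrow> complex \<Rightarrow> complex \<Rightarrow> bool" where
  "mixed_condition z0 z1 z2 \<longleftrightarrow>
     cmod z0 \<le> 2 * sqrt (Re z1 * Re z2) \<and> Re z1 \<le> 0 \<and> Re z2 \<le> 0"

end

theory Submission
  imports Defs
begin

text \<open>
  Put \<open>\<sigma> = ((1 + \<theta>z1)/(1 - \<theta>z1)) ((1 + \<theta>z2)/(1 - \<theta>z2))\<close> and \<open>v = \<sigma> + 2\<theta>z0/p\<close>. The condition on
  the \<open>zj\<close> gives \<open>\<bar>\<sigma>\<bar> + \<bar>v - \<sigma>\<bar> \<le> 1\<close>, and with \<open>k = 1/(2\<theta>)\<close>, \<open>m = 1 - k (1 - v)\<close> one finds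
  \<open>S = R + (w0/2)(R - 1) + w0 (1 + w0/2) Q\<close>, where \<open>R = (m (1 + m) + (1 - m) \<sigma>)/2\<close> is the value at
  \<open>w0 = 0\<close> and \<open>\<bar>Q\<bar> \<le> L\<close>. Hence \<open>\<bar>S\<bar> \<le> exp ((1 + L) \<bar>w0\<bar>)\<close> as soon as \<open>\<bar>R\<bar> \<le> 1\<close>.

  The bound \<open>\<bar>R\<bar> \<le> 1\<close> is elementary for real arguments. For complex ones, fix \<open>v\<close> and let \<open>\<sigma>\<close>
  range over the ellipse with foci \<open>0\<close> and \<open>v\<close>: writing \<open>\<sigma> = \<bar>\<sigma>\<bar> v + \<tau>\<close>, the affine function \<open>R\<close> of
  \<open>\<sigma>\<close> is interpolated between its values \<open>R0\<close>, \<open>R1\<close> at the foci, and the error due to \<open>\<tau>\<close> is absorbed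
  by \<open>1 - \<bar>R0\<bar> \<ge> k \<bar>1 - v\<bar>\<^sup>2/8\<close> and \<open>1 - \<bar>R1\<bar> \<ge> k (1 - \<bar>v\<bar>\<^sup>2)/2\<close>.
\<close>

section \<open>Moduli of the Cayley factors and the mixed term\<close>

lemma cmod_cayley:
  fixes \<theta> :: real and z :: complex
  shows "(cmod (1 + of_real \<theta> * z))\<^sup>2 = (cmod (1 - of_real \<theta> * z))\<^sup>2 + 4 * \<theta> * Re z"
  unfolding cmod_power2 by (simp add: power2_eq_square algebra_simps)

lemma cmod_one_minus_ge_1:
  fixes \<theta> :: real and z :: complex
  assumes "\<theta> > 0" "Re z \<le> 0"
  shows "cmod (1 - of_real \<theta> * z) \<ge> 1"
proof -
  have "\<theta> * Re z \<le> 0" using assms by (simp add: mult_nonneg_nonpos)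
  then show ?thesis using complex_Re_le_cmod[of "1 - of_real \<theta> * z"] by simp
qed

text \<open>With \<open>a\<close>, \<open>b\<close>, \<open>c\<close>, \<open>d\<close> for the four
  moduli, squaring the mixed condition bounds \<open>(2 * \<theta> * cmod z0)^2\<close> by
  \<open>(a^2 - c^2) * (b^2 - d^2) = (a * b - c * d)^2 - (a * d - c * b)^2\<close>. Dropping the
  last square and taking roots gives the claim.\<close>

lemma mixed_term_bound:
  fixes \<theta> :: real and z0 z1 z2 :: complex
  assumes "\<theta> > 0" "mixed_condition z0 z1 z2"
  shows "cmod (1 + of_real \<theta> * z1) * cmod (1 + of_real \<theta> * z2) + 2 * \<theta> * cmod z0
          \<le> cmod (1 - of_real \<theta> * z1) * cmod (1 - of_real \<theta> * z2)"
proof -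
  define a b c d where "a = cmod (1 - of_real \<theta> * z1)" "b = cmod (1 - of_real \<theta> * z2)"
    "c = cmod (1 + of_real \<theta> * z1)" "d = cmod (1 + of_real \<theta> * z2)"
  note defs = this
  have Re: "Re z1 \<le> 0" "Re z2 \<le> 0" and z0: "cmod z0 \<le> 2 * sqrt (Re z1 * Re z2)"
    using assms(2) by (auto simp: mixed_condition_def)
  have sq: "c\<^sup>2 = a\<^sup>2 + 4 * \<theta> * Re z1" "d\<^sup>2 = b\<^sup>2 + 4 * \<theta> * Re z2"
    unfolding defs by (rule cmod_cayley)+
  have nn: "a \<ge> 0" "b \<ge> 0" "c \<ge> 0" "d \<ge> 0" unfolding defs by auto
  have "\<theta> * Re z1 \<le> 0" "\<theta> * Re z2 \<le> 0" using assms(1) Re by (auto simp: mult_nonneg_nonpos)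
  then have "c\<^sup>2 \<le> a\<^sup>2" "d\<^sup>2 \<le> b\<^sup>2" using sq by auto
  then have "c \<le> a" "d \<le> b" using nn by (auto intro: power2_le_imp_le)
  then have le: "c * d \<le> a * b" using nn by (intro mult_mono)
  have "(2 * \<theta> * cmod z0)\<^sup>2 \<le> (2 * \<theta> * (2 * sqrt (Re z1 * Re z2)))\<^sup>2"
    using z0 assms(1) by (intro power_mono mult_left_mono) auto
  also have "\<dots> = (4 * \<theta> * Re z1) * (4 * \<theta> * Re z2)"
    using Re by (simp add: power_mult_distrib mult_nonpos_nonpos power2_eq_square)
  also have "\<dots> = (c\<^sup>2 - a\<^sup>2) * (d\<^sup>2 - b\<^sup>2)" by (simp add: sq)
  also have "\<dots> = (a * b - c * d)\<^sup>2 - (a * d - c * b)\<^sup>2" by (simp add: power2_eq_square algebra_simps)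
  also have "\<dots> \<le> (a * b - c * d)\<^sup>2" by simp
  finally have "2 * \<theta> * cmod z0 \<le> a * b - c * d" using le by (auto intro: power2_le_imp_le)
  then show ?thesis unfolding defs by simp
qed

section \<open>Bounded coordinates for the stability function\<close>

text \<open>Division by \<open>p\<close> replaces the unbounded \<open>zj\<close> by bounded
  quantities: \<open>z0 / p = (v - \<sigma>) / (2 * \<theta>)\<close> and
  \<open>(z1 + z2) / p = (\<sigma> - 1) / (2 * \<theta>)\<close>. Hence the value at
  \<open>w = 0\<close> depends on \<open>\<sigma>\<close> and \<open>v\<close> alone.\<close>

lemma mcs2_stab_coordinates:
  fixes \<theta> :: real and w z0 z1 z2 :: complex
  assumes \<theta>: "\<theta> > 0" and mix: "mixed_condition z0 z1 z2"
  obtains \<sigma> v q m R Q :: complex where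
    "cmod \<sigma> + cmod (v - \<sigma>) \<le> 1" "cmod q \<le> 1"
    "m = 1 - (1 - v) / (2 * of_real \<theta>)"
    "R = (m * (1 + m) + (1 - m) * \<sigma>) / 2"
    "Q = q * (1 + (v - \<sigma>) / (4 * of_real \<theta>) + (1/2 - of_real \<theta>) * ((\<sigma> - 1) / (2 * of_real \<theta>)))"
    "mcs2_stab \<theta> w z0 z1 z2 = R + w / 2 * (R - 1) + w * (1 + w / 2) * Q"
    "z0 \<in> \<real> \<Longrightarrow> z1 \<in> \<real> \<Longrightarrow> z2 \<in> \<real> \<Longrightarrow> \<sigma> \<in> \<real> \<and> v \<in> \<real>"
proof -
  define t where "t = complex_of_real \<theta>"
  have t0: "t \<noteq> 0" using \<theta> by (simp add: t_def)
  define a where "a = 1 - t * z1"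
  define b where "b = 1 - t * z2"
  define q where "q = 1 / (a * b)"
  define \<sigma> where "\<sigma> = (1 + t * z1) * (1 + t * z2) * q"
  define v where "v = \<sigma> + 2 * t * z0 * q"
  define m where "m = 1 - (1 - v) / (2 * t)"
  define R where "R = (m * (1 + m) + (1 - m) * \<sigma>) / 2"
  define Q where "Q = q * (1 + (v - \<sigma>) / (4 * t) + (1/2 - t) * ((\<sigma> - 1) / (2 * t)))"
  have Re: "Re z1 \<le> 0" "Re z2 \<le> 0" using mix by (auto simp: mixed_condition_def)
  have ge1: "cmod a \<ge> 1" "cmod b \<ge> 1"
    unfolding a_def b_def t_def using cmod_one_minus_ge_1[OF \<theta>] Re by auto
  then have ab0: "a \<noteq> 0" "b \<noteq> 0" by auto
  have ab1: "1 * 1 \<le> cmod a * cmod b" by (rule mult_mono) (use ge1 in auto)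
  have q1: "cmod q \<le> 1" using ab1 ab0 by (simp add: q_def norm_divide norm_mult)
  have "cmod \<sigma> + cmod (v - \<sigma>) =
      (cmod (1 + t * z1) * cmod (1 + t * z2) + 2 * \<theta> * cmod z0) / (cmod a * cmod b)"
    using \<theta> by (simp add: v_def \<sigma>_def q_def norm_mult norm_divide t_def add_divide_distrib)
  also have "\<dots> \<le> 1"
    using mixed_term_bound[OF \<theta> mix] ab1 by (simp add: a_def b_def t_def)
  finally have sum1: "cmod \<sigma> + cmod (v - \<sigma>) \<le> 1" .
  have z0q: "z0 * q = (v - \<sigma>) / (2 * t)" using t0 by (simp add: v_def)
  have "(\<sigma> - 1) = ((1 + t * z1) * (1 + t * z2) - a * b) * q"
    using ab0 by (simp add: \<sigma>_def q_def field_simps)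
  also have "\<dots> = 2 * t * ((z1 + z2) * q)" by (simp add: a_def b_def algebra_simps)
  finally have z12q: "(z1 + z2) * q = (\<sigma> - 1) / (2 * t)" using t0 by simp
  define y where "y = z0 + z1 + z2"
  have "y * q = z0 * q + (z1 + z2) * q" by (simp add: y_def algebra_simps)
  then have yq: "y * q = (v - 1) / (2 * t)"
    using z0q z12q by (simp add: add_divide_distrib diff_divide_distrib)
  \<comment> \<open>\<open>Q\<close> is the bracket of the stability function with the factor
    \<open>w + y\<close> removed.\<close>
  have Q': "Q = q + t * (z0 * q) * q + (1/2 - t) * (y * q) * q"
    unfolding z0q yq Q_def using t0 by (simp add: field_simps)
  have "y * Q = (y * q) * (1 + (v - \<sigma>) / (4 * t) + (1/2 - t) * ((\<sigma> - 1) / (2 * t)))"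
    by (simp add: Q_def algebra_simps)
  also have "\<dots> = R - 1"
    unfolding yq R_def m_def using t0 by (simp add: field_simps)
  finally have yQ: "R - 1 = y * Q" ..
  have div: "x / (a * b) = x * q" "x / (a * b)\<^sup>2 = x * q\<^sup>2" for x
    by (simp_all add: q_def power_divide)
  have "mcs2_stab \<theta> w z0 z1 z2 = 1 + (1 + w / 2) *
      ((w + y) * q + t * (z0 * (w + y) * q\<^sup>2) + (1/2 - t) * (y * (w + y) * q\<^sup>2))"
    by (simp add: mcs2_stab_def Let_def t_def[symmetric] a_def[symmetric] b_def[symmetric] y_def
        div add.assoc)
  also have "\<dots> = 1 + (1 + w / 2) * (w + y) * Q"
    unfolding Q' by (simp add: power2_eq_square field_simps)
  also have "\<dots> = 1 + y * Q + w / 2 * (y * Q) + w * (1 + w / 2) * Q"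
    by (simp add: algebra_simps)
  also have "\<dots> = R + w / 2 * (R - 1) + w * (1 + w / 2) * Q"
    unfolding yQ[symmetric] by simp
  finally have S: "mcs2_stab \<theta> w z0 z1 z2 = R + w / 2 * (R - 1) + w * (1 + w / 2) * Q" .
  have real: "z0 \<in> \<real> \<Longrightarrow> z1 \<in> \<real> \<Longrightarrow> z2 \<in> \<real> \<Longrightarrow> \<sigma> \<in> \<real> \<and> v \<in> \<real>"
    by (simp add: \<sigma>_def v_def q_def a_def b_def t_def)
  show thesis
    by (rule that[OF sum1 q1 m_def[unfolded t_def] R_def Q_def[unfolded t_def] S real])
qed

section \<open>Perturbation by the integral term\<close>

lemma cmod_coefficient_le:
  fixes \<theta> :: real and \<sigma> v q :: complex
  assumes \<theta>: "\<theta> > 0" and \<sigma>v: "cmod \<sigma> + cmod (v - \<sigma>) \<le> 1" and q: "cmod q \<le> 1"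
  shows "cmod (q * (1 + (v - \<sigma>) / (4 * of_real \<theta>)
            + (1/2 - of_real \<theta>) * ((\<sigma> - 1) / (2 * of_real \<theta>)))) \<le> max (1 / \<theta>) 2"
proof -
  have 1: "cmod ((v - \<sigma>) / (4 * of_real \<theta>)) \<le> 1 / (4 * \<theta>)"
  proof -
    have "cmod (v - \<sigma>) \<le> 1" using \<sigma>v norm_ge_zero[of \<sigma>] by linarith
    then show ?thesis using \<theta> by (simp add: norm_divide norm_mult field_simps)
  qed
  have 2: "cmod ((\<sigma> - 1) / (2 * of_real \<theta>)) \<le> 1 / \<theta>"
  proof -
    have "cmod (\<sigma> - 1) \<le> 2"
      using \<sigma>v norm_ge_zero[of "v - \<sigma>"] norm_triangle_ineq4[of \<sigma> 1]
      unfolding norm_one by linarith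
    then show ?thesis using \<theta> by (simp add: norm_divide norm_mult field_simps)
  qed
  have 3: "cmod (1/2 - of_real \<theta>) = \<bar>1/2 - \<theta>\<bar>"
    using norm_of_real[of "1/2 - \<theta>", where 'a=complex] by simp
  let ?s = "1 + (v - \<sigma>) / (4 * of_real \<theta>) + (1/2 - of_real \<theta>) * ((\<sigma> - 1) / (2 * of_real \<theta>))"
  have "cmod ?s \<le> 1 + cmod ((v - \<sigma>) / (4 * of_real \<theta>))
      + cmod ((1/2 - of_real \<theta>) * ((\<sigma> - 1) / (2 * of_real \<theta>)))"
    by (intro order_trans[OF norm_triangle_ineq] add_mono) auto
  also have "\<dots> \<le> 1 + 1 / (4 * \<theta>) + \<bar>1/2 - \<theta>\<bar> * (1 / \<theta>)"
    unfolding norm_mult[of "1/2 - of_real \<theta>"] 3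
    by (intro add_mono mult_left_mono 1 2) auto
  \<comment> \<open>The sum equals \<open>2 - 1 / (4 * \<theta>)\<close> for
    \<open>\<theta> \<ge> 1/2\<close> and \<open>3 / (4 * \<theta>)\<close> below, whence the two
    branches of the maximum.\<close>
  also have "\<dots> \<le> max (1 / \<theta>) 2"
    using \<theta> by (cases "\<theta> \<ge> 1/2") (auto simp: field_simps max_def)
  finally have "cmod q * cmod ?s \<le> 1 * max (1 / \<theta>) 2"
    using q by (intro mult_mono) auto
  then show ?thesis by (simp add: norm_mult)
qed

text \<open>The triangle inequality yields a quadratic in \<open>cmod w\<close> that is dominated
  term by term by the second Taylor polynomial of the exponential.\<close>

lemma cmod_stab_le_exp:
  fixes w R Q :: complex
  assumes R: "cmod R \<le> 1" and Q: "cmod Q \<le> L"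
  shows "cmod (R + w / 2 * (R - 1) + w * (1 + w / 2) * Q) \<le> exp ((1 + L) * cmod w)"
proof -
  define x where "x = cmod w"
  have x0: "x \<ge> 0" and L0: "L \<ge> 0" using order_trans[OF norm_ge_zero Q] by (simp_all add: x_def)
  have "cmod (1 + w / 2) \<le> 1 + x / 2"
    using norm_triangle_ineq[of 1 "w / 2"] by (simp add: x_def norm_divide)
  then have "cmod w * cmod (1 + w / 2) * cmod Q \<le> x * (1 + x / 2) * L"
    using Q x0 by (intro mult_mono) (auto simp: x_def)
  moreover have "cmod (w / 2) * cmod (R - 1) \<le> x / 2 * 2"
    using R norm_triangle_ineq4[of R 1] by (intro mult_mono) (auto simp: x_def norm_divide)
  ultimately have "cmod (R + w / 2 * (R - 1) + w * (1 + w / 2) * Q) \<le> 1 + x + x * (1 + x / 2) * L"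
    using R norm_triangle_ineq[of "R + w / 2 * (R - 1)" "w * (1 + w / 2) * Q"]
      norm_triangle_ineq[of R "w / 2 * (R - 1)"] by (simp add: norm_mult)
  also have "\<dots> = 1 + (1 + L) * x + L * x\<^sup>2 / 2" by (simp add: field_simps power2_eq_square)
  also have "\<dots> \<le> 1 + (1 + L) * x + ((1 + L) * x)\<^sup>2 / 2"
  proof -
    have "L \<le> (1 + L)\<^sup>2" using L0 by (simp add: power2_eq_square algebra_simps)
    then have "L * x\<^sup>2 \<le> (1 + L)\<^sup>2 * x\<^sup>2" by (rule mult_right_mono) simp
    then show ?thesis by (simp add: power_mult_distrib)
  qed
  also have "\<dots> \<le> exp ((1 + L) * x)"
    using exp_lower_Taylor_quadratic[of "(1 + L) * x"] x0 L0 by simp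
  finally show ?thesis by (simp add: x_def)
qed

section \<open>The unperturbed factor: real arguments\<close>

text \<open>The gap to the upper bound is \<open>(1 - m) * (2 + m - \<sigma>) / 2\<close>; from
  \<open>k \<le> 3/2\<close> and \<open>2 * \<sigma> \<le> 1 + v\<close> the second factor is at
  least \<open>1 + v\<close>. For the lower bound, replacing \<open>\<sigma>\<close> by
  \<open>-1\<close> leaves the gap \<open>(1 + m)^2 / 2\<close>.\<close>

lemma real_amplification_le_1:
  fixes k \<sigma> v m :: real
  assumes k: "0 < k" "k \<le> 3/2" and \<sigma>v: "\<bar>\<sigma>\<bar> + \<bar>v - \<sigma>\<bar> \<le> 1" and m: "m = 1 - k * (1 - v)"
  shows "\<bar>(m * (1 + m) + (1 - m) * \<sigma>) / 2\<bar> \<le> 1"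
proof -
  have v: "v \<le> 1" "v \<ge> -1" and \<sigma>: "\<sigma> \<ge> -1" and \<sigma>2: "2 * \<sigma> \<le> 1 + v" using \<sigma>v by linarith+
  have m1: "m \<le> 1" using k v by (simp add: m)
  have kd: "k * (1 - v) \<le> 3/2 * (1 - v)" using k v by (intro mult_right_mono) auto
  have "2 + m - \<sigma> \<ge> 0" using kd \<sigma>2 v unfolding m by (simp add: algebra_simps)
  then have "(1 - m) * (2 + m - \<sigma>) \<ge> 0" using m1 by simp
  moreover have "(1 - m) * \<sigma> \<ge> (1 - m) * (- 1)" using m1 \<sigma> by (intro mult_left_mono) auto
  moreover have "(1 + m) * (1 + m) \<ge> 0" by simp
  ultimately show ?thesis unfolding abs_le_iff by (simp add: algebra_simps)
qed

section \<open>The unperturbed factor: complex arguments\<close>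

lemma one_minus_ge_if_square_le:
  fixes r c :: real
  assumes "r\<^sup>2 \<le> 1 - c"
  shows "1 - r \<ge> c / 2"
  using assms zero_le_power2[of "r - 1"] by (simp add: power2_eq_square algebra_simps)

text \<open>The point \<open>m\<close> lies on the segment from \<open>1\<close> to
  \<open>v\<close>, hence in the unit disc, and \<open>(1 + m) / 2\<close> is the midpoint of
  \<open>1\<close> and \<open>m\<close>. The parallelogram law with
  \<open>1 - m = k * (1 - v)\<close> quantifies how far this midpoint is inside.\<close>

lemma one_minus_cmod_first_focus:
  fixes k :: real and v m :: complex
  assumes k: "0 \<le> k" "k \<le> 1" and v: "cmod v \<le> 1" and m: "m = 1 - of_real k * (1 - v)"
  shows "1 - cmod (m * (1 + m) / 2) \<ge> k * (cmod (1 - v))\<^sup>2 / 8"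
proof -
  define D where "D = (cmod (1 - v))\<^sup>2"
  have D0: "D \<ge> 0" by (simp add: D_def)
  have v2: "(cmod v)\<^sup>2 \<le> 1" using v by (simp add: power_le_one)
  have mm: "(cmod m)\<^sup>2 = 1 - k + k * (cmod v)\<^sup>2 - k * (1 - k) * D"
    unfolding D_def cmod_power2 m by (simp add: power2_eq_square algebra_simps)
  have k1: "k * (cmod v)\<^sup>2 \<le> k" using k v2 by (simp add: mult_left_le)
  have k2: "0 \<le> k * (1 - k) * D" using k D0 by simp
  have "(cmod m)\<^sup>2 \<le> 1\<^sup>2" using mm k1 k2 by simp
  then have m1: "cmod m \<le> 1" by (rule power2_le_imp_le) simp
  have "(cmod (1 + m))\<^sup>2 = 2 + 2 * (cmod m)\<^sup>2 - k\<^sup>2 * D"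
    unfolding D_def cmod_power2 m by (simp add: power2_eq_square algebra_simps)
  also have "\<dots> \<le> 4 - (2 * k - k\<^sup>2) * D"
    unfolding mm using k1 by (simp add: power2_eq_square algebra_simps)
  finally have "(cmod (1 + m) / 2)\<^sup>2 \<le> 1 - (2 * k - k\<^sup>2) * D / 4"
    by (simp add: power_divide)
  then have "1 - cmod (1 + m) / 2 \<ge> (2 * k - k\<^sup>2) * D / 4 / 2" by (rule one_minus_ge_if_square_le)
  moreover have "k * D \<le> (2 * k - k\<^sup>2) * D"
    using k D0 by (intro mult_right_mono) (auto simp: power2_eq_square mult_left_le)
  moreover have "cmod m * cmod (1 + m) \<le> 1 * cmod (1 + m)"
    using m1 by (intro mult_right_mono) auto
  ultimately show ?thesis by (simp add: D_def norm_mult norm_divide)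
qed

text \<open>This is the focus \<open>\<sigma> = v\<close>. The gap is measured by
  \<open>1 - (cmod v)^2\<close> because the bound on the deviation \<open>\<tau>\<close> carries the
  same factor.\<close>

lemma one_minus_cmod_second_focus:
  fixes k :: real and v m :: complex
  assumes k: "0 \<le> k" "k \<le> 1" and v: "cmod v \<le> 1" and m: "m = 1 - of_real k * (1 - v)"
  shows "1 - cmod ((m * (1 + m) + (1 - m) * v) / 2) \<ge> k * (1 - (cmod v)\<^sup>2) / 2"
proof -
  define d where "d = 1 - (cmod v)\<^sup>2"
  define E where "E = 2 - 2 * Re v"
  define x where "x = Re v"
  define A where "A = (1 - k) * (1 - k * d / 2)"
  define B where "B = k * (1 + (1 - k) * E / 2)"
  have v2: "(cmod v)\<^sup>2 \<le> 1" using v by (simp add: power_le_one)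
  have d: "0 \<le> d" "d \<le> 1" using v2 by (auto simp: d_def)
  have E: "0 \<le> E" using complex_Re_le_cmod[of v] v by (simp add: E_def)
  have kd: "k * d \<le> 1" using mult_mono[of k 1 d 1] k d by simp
  \<comment> \<open>Reduce modulo \<open>v\<^sup>2 = 2 Re v v - \<bar>v\<bar>\<^sup>2\<close>, so that only \<open>\<bar>v\<bar>\<^sup>2\<close> and \<open>Re v\<close> enter the modulus.\<close>
  have "(m * (1 + m) + (1 - m) * v) / 2 = of_real A + of_real B * v"
    unfolding complex_eq_iff m A_def B_def d_def E_def cmod_power2
    by (simp add: power2_eq_square field_simps)
  then have "(cmod ((m * (1 + m) + (1 - m) * v) / 2))\<^sup>2 = A\<^sup>2 + B\<^sup>2 * (cmod v)\<^sup>2 + 2 * A * B * Re v"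
    unfolding cmod_power2 by (simp add: power2_eq_square algebra_simps)
  also have "\<dots> = A\<^sup>2 + B\<^sup>2 * (1 - d) + A * B * (2 - E)"
    by (simp add: d_def E_def algebra_simps)
  \<comment> \<open>What is subtracted from the square of the target is a quadratic form in
    \<open>E\<close> and \<open>d\<close> whose coefficients are nonnegative for
    \<open>0 \<le> k \<le> 1\<close>.\<close>
  also have "\<dots> = (1 - k * d / 2)\<^sup>2 - (k * (1 - k)\<^sup>2 * (1/2 - k/4) * E\<^sup>2
      + ((k * (1 - k))\<^sup>2 / 2 + k\<^sup>2 * (1 - k) / 2) * E * d + k\<^sup>2 * (1 - (1 - k)\<^sup>2) / 4 * d\<^sup>2)"
    unfolding A_def B_def by (simp add: power2_eq_square field_simps)
  also have "\<dots> \<le> (1 - k * d / 2)\<^sup>2"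
  proof -
    have "0 \<le> 1 - (1 - k)\<^sup>2" using k by (simp add: power_le_one)
    then show ?thesis
      unfolding diff_le_eq le_add_same_cancel1
      using k d E by (intro add_nonneg_nonneg mult_nonneg_nonneg divide_nonneg_nonneg) auto
  qed
  finally have "cmod ((m * (1 + m) + (1 - m) * v) / 2) \<le> 1 - k * d / 2"
    using kd by (auto intro: power2_le_imp_le)
  then show ?thesis by (simp add: d_def)
qed

text \<open>Squaring \<open>cmod (v - \<sigma>) \<le> 1 - cmod \<sigma>\<close> bounds the inner
  product \<open>X\<close> of \<open>\<sigma>\<close> and \<open>v\<close> from below, and
  \<open>X\<close> enters the expanded left side with a nonpositive coefficient.\<close>

lemma ellipse_decomposition:
  fixes \<sigma> v :: complex
  assumes "cmod \<sigma> + cmod (v - \<sigma>) \<le> 1"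
  shows "(cmod (\<sigma> - of_real (cmod \<sigma>) * v))\<^sup>2 \<le> cmod \<sigma> * (1 - cmod \<sigma>) * (1 - (cmod v)\<^sup>2)"
proof -
  define l where "l = cmod \<sigma>"
  define X where "X = Re \<sigma> * Re v + Im \<sigma> * Im v"
  have l2: "(Re \<sigma>)\<^sup>2 + (Im \<sigma>)\<^sup>2 = l\<^sup>2" by (simp add: l_def cmod_power2)
  have N: "(cmod (v - \<sigma>))\<^sup>2 = (cmod v)\<^sup>2 - 2 * X + l\<^sup>2"
    unfolding cmod_power2 l2[symmetric] X_def by (simp add: power2_eq_square algebra_simps)
  have "(cmod (v - \<sigma>))\<^sup>2 \<le> (1 - l)\<^sup>2" using assms by (intro power_mono) (auto simp: l_def)
  then have "l * ((cmod v)\<^sup>2 - 2 * X + l\<^sup>2) \<le> l * (1 - l)\<^sup>2"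
    unfolding N by (intro mult_left_mono) (auto simp: l_def)
  moreover have "(cmod (\<sigma> - of_real l * v))\<^sup>2
      = ((Re \<sigma>)\<^sup>2 + (Im \<sigma>)\<^sup>2) - 2 * l * X + l\<^sup>2 * (cmod v)\<^sup>2"
    unfolding cmod_power2 X_def by (simp add: power2_eq_square algebra_simps)
  ultimately show ?thesis
    unfolding l_def[symmetric] l2 by (simp add: power2_eq_square algebra_simps)
qed

lemma complex_amplification_le_1:
  fixes k :: real and \<sigma> v m :: complex
  assumes k: "0 \<le> k" "k \<le> 1" and \<sigma>v: "cmod \<sigma> + cmod (v - \<sigma>) \<le> 1"
    and m: "m = 1 - of_real k * (1 - v)"
  shows "cmod ((m * (1 + m) + (1 - m) * \<sigma>) / 2) \<le> 1"
proof -
  define l where "l = cmod \<sigma>"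
  define \<tau> where "\<tau> = \<sigma> - of_real l * v"
  define R0 where "R0 = m * (1 + m) / 2"
  define R1 where "R1 = (m * (1 + m) + (1 - m) * v) / 2"
  define c where "c = cmod (1 - v)"
  define g where "g = sqrt (1 - (cmod v)\<^sup>2)"
  have v: "cmod v \<le> 1" using norm_triangle_ineq[of \<sigma> "v - \<sigma>"] \<sigma>v by simp
  have l: "0 \<le> l" "l \<le> 1" using order_trans[OF _ \<sigma>v, of "cmod \<sigma>"] by (simp_all add: l_def)
  have g2: "g\<^sup>2 = 1 - (cmod v)\<^sup>2" using v by (simp add: g_def power_le_one)
  have "(cmod \<tau>)\<^sup>2 \<le> (sqrt l * sqrt (1 - l) * g)\<^sup>2"
    using ellipse_decomposition[OF \<sigma>v] l g2 by (simp add: \<tau>_def l_def power_mult_distrib)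
  then have \<tau>: "cmod \<tau> \<le> sqrt l * sqrt (1 - l) * g"
    by (rule power2_le_imp_le) (use l v in \<open>simp add: g_def power_le_one\<close>)
  have R0: "cmod R0 \<le> 1 - k * c\<^sup>2 / 8"
    using one_minus_cmod_first_focus[OF k v m] by (simp add: R0_def c_def)
  have R1: "cmod R1 \<le> 1 - k * g\<^sup>2 / 2"
    using one_minus_cmod_second_focus[OF k v m] by (simp add: R1_def g2)
  \<comment> \<open>The expression is affine in \<open>\<sigma> = l * v + \<tau>\<close> with slope
    \<open>(1 - m) / 2 = k / 2 * (1 - v)\<close>.\<close>
  have "(m * (1 + m) + (1 - m) * \<sigma>) / 2
      = of_real (1 - l) * R0 + of_real l * R1 + of_real (k / 2) * (1 - v) * \<tau>"
    unfolding R0_def R1_def \<tau>_def m by (simp add: field_simps)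
  also have "cmod \<dots> \<le> cmod (of_real (1 - l) * R0) + cmod (of_real l * R1)
      + cmod (of_real (k / 2) * (1 - v) * \<tau>)"
    by (intro order_trans[OF norm_triangle_ineq] add_mono norm_triangle_ineq order_refl)
  also have "\<dots> = (1 - l) * cmod R0 + l * cmod R1 + k / 2 * c * cmod \<tau>"
    unfolding norm_mult norm_of_real using k l by (simp add: c_def)
  also have "\<dots> \<le> (1 - l) * (1 - k * c\<^sup>2 / 8) + l * (1 - k * g\<^sup>2 / 2)
      + k / 2 * c * (sqrt l * sqrt (1 - l) * g)"
    using k l by (intro add_mono mult_left_mono R0 R1 \<tau>) (auto simp: c_def)
  \<comment> \<open>The constants \<open>1/8\<close> and \<open>1/2\<close> of the two focus
    estimates are what makes the cross term complete a square.\<close>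
  also have "\<dots> = 1 - k / 8 * (sqrt (1 - l) * c - 2 * (sqrt l * g))\<^sup>2"
    using l by (simp add: power2_diff power_mult_distrib) (simp add: field_simps)
  also have "\<dots> \<le> 1" using k by simp
  finally show ?thesis .
qed

section \<open>From one step to \<open>n\<close> steps\<close>

lemma cmod_power_le_exp:
  fixes x :: complex
  assumes "cmod x \<le> exp (c * cmod w)" "0 \<le> c" "cmod w \<le> lam * dt" "real n * dt \<le> T" "lam \<ge> 0"
  shows "cmod (x ^ n) \<le> exp (c * lam * T)"
proof -
  have "cmod (x ^ n) \<le> exp (c * cmod w) ^ n"
    unfolding norm_power using assms(1) by (intro power_mono) auto
  also have "\<dots> = exp (real n * (c * cmod w))" by (simp add: exp_of_nat_mult)
  also have "\<dots> \<le> exp (real n * (c * (lam * dt)))"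
    using assms by (auto intro!: mult_left_mono)
  also have "\<dots> = exp (c * lam * (real n * dt))" by (simp add: ac_simps)
  also have "\<dots> \<le> exp (c * lam * T)" using assms by (auto intro!: mult_left_mono)
  finally show ?thesis .
qed

lemma cmod_mcs2_stab_le_exp:
  assumes \<theta>: "\<theta> > 0" and mix: "mixed_condition z0 z1 z2"
    and "\<theta> \<ge> 1/2 \<or> (\<theta> \<ge> 1/3 \<and> z0 \<in> \<real> \<and> z1 \<in> \<real> \<and> z2 \<in> \<real>)"
  shows "cmod (mcs2_stab \<theta> w z0 z1 z2) \<le> exp ((1 + max (1 / \<theta>) 2) * cmod w)"
proof -
  obtain \<sigma> v q m R Q where \<sigma>v: "cmod \<sigma> + cmod (v - \<sigma>) \<le> 1" and q: "cmod q \<le> 1"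
    and m: "m = 1 - (1 - v) / (2 * of_real \<theta>)"
    and R: "R = (m * (1 + m) + (1 - m) * \<sigma>) / 2"
    and Q: "Q = q * (1 + (v - \<sigma>) / (4 * of_real \<theta>)
                  + (1/2 - of_real \<theta>) * ((\<sigma> - 1) / (2 * of_real \<theta>)))"
    and S: "mcs2_stab \<theta> w z0 z1 z2 = R + w / 2 * (R - 1) + w * (1 + w / 2) * Q"
    and real: "z0 \<in> \<real> \<Longrightarrow> z1 \<in> \<real> \<Longrightarrow> z2 \<in> \<real> \<Longrightarrow> \<sigma> \<in> \<real> \<and> v \<in> \<real>"
    using mcs2_stab_coordinates[OF \<theta> mix, of w] by metis
  \<comment> \<open>In terms of \<open>k\<close>, the thresholds \<open>\<theta> \<ge> 1/2\<close>
    and \<open>\<theta> \<ge> 1/3\<close> read \<open>k \<le> 1\<close> and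
    \<open>k \<le> 3/2\<close>, as the complex and the real estimate require.\<close>
  define k where "k = 1 / (2 * \<theta>)"
  have k0: "k > 0" using \<theta> by (simp add: k_def)
  have mk: "m = 1 - of_real k * (1 - v)" by (simp add: m k_def)
  have "cmod R \<le> 1"
    using assms(3)
  proof
    assume "\<theta> \<ge> 1/2"
    then have "k \<le> 1" using \<theta> by (simp add: k_def field_simps)
    then show ?thesis unfolding R using complex_amplification_le_1[OF _ _ \<sigma>v mk] k0 by simp
  next
    assume *: "\<theta> \<ge> 1/3 \<and> z0 \<in> \<real> \<and> z1 \<in> \<real> \<and> z2 \<in> \<real>"
    then have k: "k \<le> 3/2" using \<theta> by (simp add: k_def field_simps)
    obtain \<sigma>' v' where r: "\<sigma> = of_real \<sigma>'" "v = of_real v'"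
      using * real by (auto elim!: Reals_cases)
    define m' where "m' = 1 - k * (1 - v')"
    have "cmod \<sigma> = \<bar>\<sigma>'\<bar>" "cmod (v - \<sigma>) = \<bar>v' - \<sigma>'\<bar>"
      unfolding r of_real_diff[symmetric] norm_of_real by auto
    then have "\<bar>(m' * (1 + m') + (1 - m') * \<sigma>') / 2\<bar> \<le> 1"
      using real_amplification_le_1[OF k0 k _ m'_def] \<sigma>v by simp
    moreover have "R = of_real ((m' * (1 + m') + (1 - m') * \<sigma>') / 2)"
      by (simp add: R mk r m'_def)
    ultimately show ?thesis by (simp only: norm_of_real)
  qed
  moreover have "cmod Q \<le> max (1 / \<theta>) 2"
    unfolding Q by (rule cmod_coefficient_le[OF \<theta> \<sigma>v q])
  ultimately show ?thesis unfolding S by (rule cmod_stab_le_exp)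
qed

theorem theorem6:
  fixes \<theta> lam T dt L M :: real and n :: nat
  assumes "\<theta> > 0" and "lam > 0" and "T > 0" and "dt > 0"
    and "n \<ge> 1" and "real n * dt \<le> T"
    and "L = max (1 / \<theta>) 2"
    and "M = exp ((1 + L) * lam * T)"
  shows "(\<theta> \<ge> 1/3 \<longrightarrow>
            (\<forall>(w0::complex) (z0::real) (z1::real) (z2::real).
               cmod w0 \<le> lam * dt \<longrightarrow>
               mixed_condition (complex_of_real z0) (complex_of_real z1) (complex_of_real z2) \<longrightarrow>
               cmod (mcs2_stab \<theta> w0 (complex_of_real z0) (complex_of_real z1) (complex_of_real z2) ^ n) \<le> M))
       \<and> (1/2 \<le> \<theta> \<and> \<theta> \<le> 1 \<longrightarrow>
            (\<forall>(w0::complex) (z0::complex) (z1::complex) (z2::complex).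
               cmod w0 \<le> lam * dt \<longrightarrow>
               mixed_condition z0 z1 z2 \<longrightarrow>
               cmod (mcs2_stab \<theta> w0 z0 z1 z2 ^ n) \<le> M))"
proof -
  have le_M: "cmod (mcs2_stab \<theta> w0 z0 z1 z2 ^ n) \<le> M"
    if "cmod w0 \<le> lam * dt" "mixed_condition z0 z1 z2"
      "\<theta> \<ge> 1/2 \<or> (\<theta> \<ge> 1/3 \<and> z0 \<in> \<real> \<and> z1 \<in> \<real> \<and> z2 \<in> \<real>)" for w0 z0 z1 z2
    unfolding \<open>M = _\<close> \<open>L = _\<close>
    using cmod_mcs2_stab_le_exp[OF \<open>\<theta> > 0\<close> that(2,3)] that(1) assms
    by (intro cmod_power_le_exp[where w = w0 and dt = dt]) auto
  show ?thesis by (auto intro!: le_M)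
qed

end
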